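(* Let $G$ be a finite simple graph that is $(P_3 \cup P_2)$-free, and let $\omega = \omega(G)$ be its clique number. Then $\chi(G) \leq \frac{\omega(\omega+1)(\omega+2)}{6}$.
   Context: A graph $G$ is $H$-free if $G$ contains no induced subgraph isomorphic to $H$. $P_n$ denotes the path on $n$ vertices, and $P_3 \cup P_2$ denotes the disjoint union of a path on 3 vertices and a path on 2 vertices (with no edges between them). $\chi(G)$ is the chromatic number and $\omega(G)$ the clique number (size of a largest clique) of $G$. *)

theory Defs
  imports Complex_Main "Graph_Theory.Graph_Theory"
begin

text \<open>
  Finite simple graphs are the graphs of the locale \<^locale>\<open>graph\<close>: finite, loop-free, symmetric
  digraphs without parallel arcs, an edge being a pair of opposite arcs. Adjacency of \<open>u\<close> and \<open>v\<close>
  in \<open>G\<close> is \<open>u \<rightarrow>\<^bsub>G\<^esub> v\<close>. The graph without vertices is included.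
\<close>

definition path_graph :: "nat \<Rightarrow> nat pair_pre_digraph" where
  "path_graph n = \<lparr> pverts = {..<n},
     parcs = {(i, j). i < n \<and> j < n \<and> (j = Suc i \<or> i = Suc j)} \<rparr>"

definition disjoint_union_graph ::
    "'a pair_pre_digraph \<Rightarrow> 'b pair_pre_digraph \<Rightarrow> ('a + 'b) pair_pre_digraph" where
  "disjoint_union_graph A B = \<lparr> pverts = pverts A <+> pverts B,
     parcs = {(Inl u, Inl v) | u v. (u, v) \<in> parcs A} \<union> {(Inr u, Inr v) | u v. (u, v) \<in> parcs B} \<rparr>"

definition induced_free :: "('c, 'd) pre_digraph \<Rightarrow> ('a, 'b) pre_digraph \<Rightarrow> bool" where
  "induced_free F G \<longleftrightarrow> \<not> (\<exists>H. induced_subgraph H G \<and> digraph_iso H F)"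

definition is_clique :: "('a, 'b) pre_digraph \<Rightarrow> 'a set \<Rightarrow> bool" where
  "is_clique G K \<longleftrightarrow> K \<subseteq> verts G \<and> (\<forall>u\<in>K. \<forall>v\<in>K. u \<noteq> v \<longrightarrow> u \<rightarrow>\<^bsub>G\<^esub> v)"

definition clique_number :: "('a, 'b) pre_digraph \<Rightarrow> nat" where
  "clique_number G = Max {card K | K. is_clique G K}"

definition proper_coloring :: "('a, 'b) pre_digraph \<Rightarrow> nat \<Rightarrow> ('a \<Rightarrow> nat) \<Rightarrow> bool" where
  "proper_coloring G k c \<longleftrightarrow>
     c ` verts G \<subseteq> {..<k} \<and> (\<forall>u\<in>verts G. \<forall>v\<in>verts G. u \<rightarrow>\<^bsub>G\<^esub> v \<longrightarrow> c u \<noteq> c v)"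

definition chromatic_number :: "('a, 'b) pre_digraph \<Rightarrow> nat" where
  "chromatic_number G = (LEAST k. \<exists>c. proper_coloring G k c)"

end

(* Fix a maximum clique a_0, ..., a_{w-1}. By maximality every vertex v has a non-neighbour in it
   (v itself, if v lies in the clique). Let a_i be the first one, and let a_j be the second one, with
   j = w if there is none. For fixed i < j <= w the vertices of this kind see the other j - 1 vertices
   among a_0, ..., a_{j-1}, so their cliques have at most w + 1 - j vertices. If j < w, then they are
   anticomplete to the edge a_i a_j, so they induce a P_3-free graph; if j = w, then they are
   pairwise non-adjacent. Either way w + 1 - j colours suffice for them, and the sum of
   j (w + 1 - j) over j <= w is w (w + 1) (w + 2) / 6. *)

theory Submission
  imports Defs
begin

section \<open>Colourings of vertex sets\<close>

text \<open>A relation and a vertex set take the place of a graph, so that classes of vertices can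
  be coloured separately and combined without forming subgraphs. For \<open>arcs_ends G\<close> and
  \<open>verts G\<close> this is the existence of a \<open>proper_coloring\<close>.\<close>

definition colorable :: "('a \<times> 'a) set \<Rightarrow> 'a set \<Rightarrow> nat \<Rightarrow> bool" where
  "colorable r S k \<longleftrightarrow>
     (\<exists>c::'a \<Rightarrow> nat. c ` S \<subseteq> {..<k} \<and> (\<forall>u\<in>S. \<forall>v\<in>S. (u, v) \<in> r \<longrightarrow> c u \<noteq> c v))"

lemma colorable_mono:
  assumes "colorable r T k" "S \<subseteq> T"
  shows "colorable r S k"
proof -
  obtain c :: "'a \<Rightarrow> nat"
    where c: "c ` T \<subseteq> {..<k}" "\<forall>u\<in>T. \<forall>v\<in>T. (u, v) \<in> r \<longrightarrow> c u \<noteq> c v"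
    using assms(1) unfolding colorable_def by (elim exE conjE)
  have "c ` S \<subseteq> {..<k}"
    using c(1) assms(2) by auto
  moreover have "\<forall>u\<in>S. \<forall>v\<in>S. (u, v) \<in> r \<longrightarrow> c u \<noteq> c v"
    using c(2) assms(2) by (meson subsetD)
  ultimately show ?thesis
    unfolding colorable_def by (intro exI conjI)
qed

lemma colorable_Un:
  assumes "colorable r S k" "colorable r T l"
  shows "colorable r (S \<union> T) (k + l)"
proof -
  obtain c :: "'a \<Rightarrow> nat"
    where c: "\<And>u. u \<in> S \<Longrightarrow> c u < k" "\<And>u v. u \<in> S \<Longrightarrow> v \<in> S \<Longrightarrow> (u, v) \<in> r \<Longrightarrow> c u \<noteq> c v"
    using assms(1) unfolding colorable_def by blast
  obtain d :: "'a \<Rightarrow> nat"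
    where d: "\<And>u. u \<in> T \<Longrightarrow> d u < l" "\<And>u v. u \<in> T \<Longrightarrow> v \<in> T \<Longrightarrow> (u, v) \<in> r \<Longrightarrow> d u \<noteq> d v"
    using assms(2) unfolding colorable_def by blast
  \<comment> \<open>The colours of \<open>T\<close> are shifted past those of \<open>S\<close>, so
    edges between the two sets need no care. A vertex in both sets keeps its colour from
    \<open>S\<close>.\<close>
  define e where "e u = (if u \<in> S then c u else k + d u)" for u
  have "e ` (S \<union> T) \<subseteq> {..<k + l}"
    using c(1) d(1) by (fastforce simp: e_def)
  moreover have "e u \<noteq> e v" if "u \<in> S \<union> T" "v \<in> S \<union> T" "(u, v) \<in> r" for u v
    using that c(1)[of u] c(1)[of v] c(2)[of u v] d(2)[of u v] by (auto simp: e_def)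
  ultimately show ?thesis
    unfolding colorable_def by blast
qed

lemma colorable_UN:
  assumes "finite I" "\<And>i. i \<in> I \<Longrightarrow> colorable r (S i) (k i)"
  shows "colorable r (\<Union>i\<in>I. S i) (\<Sum>i\<in>I. k i)"
  using assms
proof (induction I rule: finite_induct)
  case empty
  then show ?case by (simp add: colorable_def)
next
  case (insert i I)
  then show ?case by (simp add: colorable_Un)
qed

text \<open>Greedy colouring, one vertex \<open>x\<close> at a time. Any two coloured neighbours of
  \<open>x\<close> are adjacent, being joined through \<open>x\<close>, so together with
  \<open>x\<close> they form a clique. Hence \<open>x\<close> has at most \<open>k - 1\<close>
  coloured neighbours, and one of the \<open>k\<close> colours is free.\<close>

lemma colorable_P3_free:
  assumes "finite S" "sym r" "irrefl r"
    and "\<And>u v w. \<lbrakk>u \<in> S; v \<in> S; w \<in> S; (u, v) \<in> r; (v, w) \<in> r; u \<noteq> w\<rbrakk> \<Longrightarrow> (u, w) \<in> r"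
    and "\<And>K. K \<subseteq> S \<Longrightarrow> (\<forall>u\<in>K. \<forall>v\<in>K. u \<noteq> v \<longrightarrow> (u, v) \<in> r) \<Longrightarrow> card K \<le> k"
  shows "colorable r S k"
  using assms(1,4,5)
proof (induction S rule: finite_induct)
  case empty
  then show ?case by (simp add: colorable_def)
next
  case (insert x S)
  have "colorable r S k"
  proof (rule insert.IH)
    show "(u, w) \<in> r" if "u \<in> S" "v \<in> S" "w \<in> S" "(u, v) \<in> r" "(v, w) \<in> r" "u \<noteq> w" for u v w
      using insert.prems(1)[of u v w] that by blast
    show "card K \<le> k" if "K \<subseteq> S" "\<forall>u\<in>K. \<forall>v\<in>K. u \<noteq> v \<longrightarrow> (u, v) \<in> r" for K
      using insert.prems(2)[of K] that by blast
  qed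
  then obtain c :: "'a \<Rightarrow> nat"
    where c: "c ` S \<subseteq> {..<k}" "\<And>u v. u \<in> S \<Longrightarrow> v \<in> S \<Longrightarrow> (u, v) \<in> r \<Longrightarrow> c u \<noteq> c v"
    unfolding colorable_def by blast
  define N where "N = {u \<in> S. (u, x) \<in> r}"
  have symD: "(u, v) \<in> r \<Longrightarrow> (v, u) \<in> r" for u v
    using \<open>sym r\<close> by (rule symD)
  have clique: "(u, v) \<in> r" if "u \<in> insert x N" "v \<in> insert x N" "u \<noteq> v" for u v
  proof (cases "u = x \<or> v = x")
    case True
    then show ?thesis
      using that symD unfolding N_def by blast
  next
    case False
    then show ?thesis
      using that insert.prems(1)[of u x v] symD[of v x] by (simp add: N_def)
  qed
  have "insert x N \<subseteq> insert x S"
    by (auto simp: N_def)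
  then have "card (insert x N) \<le> k"
    by (rule insert.prems(2)) (use clique in blast)
  moreover have "finite N" "x \<notin> N"
    using insert.hyps by (auto simp: N_def)
  ultimately have "card (c ` N) < k"
    using card_image_le[of N c] by simp
  then obtain y where y: "y < k" "y \<notin> c ` N"
    by (metis \<open>finite N\<close> card_lessThan card_mono finite_imageI lessThan_iff not_less subsetI)
  have "(c(x := y)) u \<noteq> (c(x := y)) v"
    if uv: "u \<in> insert x S" "v \<in> insert x S" "(u, v) \<in> r" for u v
  proof (cases "u = x \<or> v = x")
    case True
    then show ?thesis
      using uv symD[OF uv(3)] y(2) \<open>irrefl r\<close> by (auto simp: N_def irrefl_def)
  next
    case False
    then show ?thesis
      using uv c(2)[of u v] by simp
  qed
  moreover have "(c(x := y)) ` insert x S \<subseteq> {..<k}"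
    using c(1) y(1) by auto
  ultimately show ?case
    unfolding colorable_def by blast
qed

section \<open>Detecting an induced P_3 + P_2\<close>

text \<open>An isomorphism must also map arcs, which are abstract objects in \<open>G\<close>.
  Without parallel arcs an arc is determined by its ends, so an embedding of vertices is
  enough.\<close>

lemma not_induced_freeI:
  fixes g :: "'c \<Rightarrow> 'a" and G :: "('a, 'b) pre_digraph"
  assumes "nomulti_digraph G"
    and inj: "inj_on g (pverts F)" and img: "g ` pverts F \<subseteq> verts G"
    and F: "parcs F \<subseteq> pverts F \<times> pverts F"
    and adj: "\<And>u v. u \<in> pverts F \<Longrightarrow> v \<in> pverts F \<Longrightarrow> (u, v) \<in> parcs F \<longleftrightarrow> g u \<rightarrow>\<^bsub>G\<^esub> g v"
  shows "\<not> induced_free (with_proj F) G"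
proof -
  interpret nomulti_digraph G by fact
  define H where "H = G \<restriction> (g ` pverts F)"
  define h where "h = the_inv_into (pverts F) g"
  \<comment> \<open>The isomorphism runs from the subgraph to \<open>F\<close>, hence the inverse
    \<open>h\<close> of \<open>g\<close>. The arcs of \<open>with_proj F\<close> are pairs, so each
    arc goes to the pair of images of its ends, with \<open>fst\<close> and \<open>snd\<close> as
    the new tail and head.\<close>
  define f where "f = \<lparr>iso_verts = h, iso_arcs = (\<lambda>e. (h (tail G e), h (head G e))),
    iso_head = snd, iso_tail = fst\<rparr>"
  have ind: "induced_subgraph H G"
    unfolding H_def using img by (rule induced_induce)
  have hg: "h (g u) = u" if "u \<in> pverts F" for u
    using that inj by (simp add: h_def the_inv_into_f_f)
  have injh: "inj_on h (g ` pverts F)"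
    unfolding h_def using inj by (rule inj_on_the_inv_into)
  have "inj_on (iso_arcs f) (arcs H)"
  proof (rule inj_onI)
    fix e e' assume "e \<in> arcs H" "e' \<in> arcs H" "iso_arcs f e = iso_arcs f e'"
    then show "e = e'"
      by (intro no_multi_arcs) (auto simp: H_def f_def arc_to_ends_def hg)
  qed
  moreover have "wf_digraph H"
    using ind by (auto simp: induced_subgraph_def)
  ultimately have "pre_digraph.digraph_isomorphism H f"
    using injh by (auto simp: pre_digraph.digraph_isomorphism_def f_def H_def)
  moreover have "with_proj F = app_iso f H"
  proof (rule pre_digraph.equality)
    show "arcs (with_proj F) = arcs (app_iso f H)"
    proof (intro set_eqI iffI)
      fix p assume "p \<in> arcs (with_proj F)"
      then obtain u v where p: "p = (u, v)" "(u, v) \<in> parcs F" "u \<in> pverts F" "v \<in> pverts F"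
        using F by auto
      then have "g u \<rightarrow>\<^bsub>G\<^esub> g v"
        using adj by blast
      then obtain e where "e \<in> arcs G" "tail G e = g u" "head G e = g v"
        by (auto simp: arcs_ends_conv)
      then show "p \<in> arcs (app_iso f H)"
        using p by (auto simp: f_def H_def hg image_iff intro!: bexI[of _ e])
    next
      fix p assume "p \<in> arcs (app_iso f H)"
      then obtain e u v where e: "e \<in> arcs G" "u \<in> pverts F" "v \<in> pverts F"
          "tail G e = g u" "head G e = g v" "p = (u, v)"
        by (auto simp: f_def H_def hg)
      have "tail G e \<rightarrow>\<^bsub>G\<^esub> head G e"
        using e(1) by (simp add: arcs_ends_conv)
      then show "p \<in> arcs (with_proj F)"
        using e adj by auto
    qed
  qed (auto simp: f_def H_def hg image_image)
  ultimately show ?thesis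
    using ind by (auto simp: induced_free_def digraph_iso_def)
qed

lemma parcs_path_graph_2: "parcs (path_graph 2) = {(0, 1), (1, 0)}"
  unfolding path_graph_def by (simp add: set_eq_iff split_paired_all) presburger

lemma parcs_path_graph_3: "parcs (path_graph 3) = {(0, 1), (1, 0), (1, 2), (2, 1)}"
  unfolding path_graph_def by (simp add: set_eq_iff split_paired_all) presburger

text \<open>Otherwise \<open>u\<close>, \<open>v\<close>, \<open>w\<close> would be an induced path
  without edges to the edge \<open>x y\<close>. The conclusion has the form of the closure
  hypothesis of \<open>colorable_P3_free\<close>.\<close>

lemma induced_free_P3_P2D:
  fixes G :: "('a, 'b) pre_digraph"
  assumes "graph G"
    and free: "induced_free (with_proj (disjoint_union_graph (path_graph 3) (path_graph 2))) G"
    and path: "u \<rightarrow>\<^bsub>G\<^esub> v" "v \<rightarrow>\<^bsub>G\<^esub> w" "u \<noteq> w" and edge: "x \<rightarrow>\<^bsub>G\<^esub> y"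
    and apart: "\<And>z. z \<in> {u, v, w} \<Longrightarrow> z \<noteq> x \<and> z \<noteq> y \<and> \<not> z \<rightarrow>\<^bsub>G\<^esub> x \<and> \<not> z \<rightarrow>\<^bsub>G\<^esub> y"
  shows "u \<rightarrow>\<^bsub>G\<^esub> w"
proof (rule ccontr)
  assume uw: "\<not> u \<rightarrow>\<^bsub>G\<^esub> w"
  interpret graph G by fact
  have symD: "b \<rightarrow>\<^bsub>G\<^esub> a" if "a \<rightarrow>\<^bsub>G\<^esub> b" for a b
    using that by (rule arcs_ends_symmetric[OF sym_arcs])
  have irr: "\<not> a \<rightarrow>\<^bsub>G\<^esub> a" for a
    using adj_not_same by blast
  let ?F = "disjoint_union_graph (path_graph 3) (path_graph 2)"
  let ?g = "case_sum (\<lambda>i::nat. [u, v, w] ! i) (\<lambda>i::nat. [x, y] ! i)"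
  have V: "pverts ?F = {Inl 0, Inl 1, Inl 2, Inr 0, Inr 1}"
    by (auto simp: disjoint_union_graph_def path_graph_def)
  have A: "parcs ?F = {(Inl 0, Inl 1), (Inl 1, Inl 0), (Inl 1, Inl 2), (Inl 2, Inl 1),
      (Inr 0, Inr 1), (Inr 1, Inr 0)}"
    by (simp only: disjoint_union_graph_def parcs_path_graph_2 parcs_path_graph_3
        pair_pre_digraph.simps) auto
  have ne: "u \<noteq> v" "v \<noteq> w" "x \<noteq> y" "v \<noteq> u" "w \<noteq> v" "y \<noteq> x" "w \<noteq> u"
    using path edge irr by auto
  have ap: "u \<noteq> x" "u \<noteq> y" "v \<noteq> x" "v \<noteq> y" "w \<noteq> x" "w \<noteq> y"
    using apart by auto
  have adj: "v \<rightarrow>\<^bsub>G\<^esub> u" "w \<rightarrow>\<^bsub>G\<^esub> v" "y \<rightarrow>\<^bsub>G\<^esub> x"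
    using path edge by (auto dest: symD)
  have nadj: "\<not> u \<rightarrow>\<^bsub>G\<^esub> x" "\<not> u \<rightarrow>\<^bsub>G\<^esub> y" "\<not> v \<rightarrow>\<^bsub>G\<^esub> x" "\<not> v \<rightarrow>\<^bsub>G\<^esub> y" "\<not> w \<rightarrow>\<^bsub>G\<^esub> x" "\<not> w \<rightarrow>\<^bsub>G\<^esub> y"
    using apart by auto
  then have nadj': "\<not> x \<rightarrow>\<^bsub>G\<^esub> u" "\<not> y \<rightarrow>\<^bsub>G\<^esub> u" "\<not> x \<rightarrow>\<^bsub>G\<^esub> v" "\<not> y \<rightarrow>\<^bsub>G\<^esub> v" "\<not> x \<rightarrow>\<^bsub>G\<^esub> w" "\<not> y \<rightarrow>\<^bsub>G\<^esub> w"
    using symD by blast+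
  have wu: "\<not> w \<rightarrow>\<^bsub>G\<^esub> u"
    using uw symD by blast
  have "\<not> induced_free (with_proj ?F) G"
  proof (rule not_induced_freeI[where g = ?g])
    show "nomulti_digraph G" by unfold_locales
    show "inj_on ?g (pverts ?F)"
      unfolding V using ne ap path(3) by (auto simp: inj_on_def)
    show "?g ` pverts ?F \<subseteq> verts G"
      unfolding V using path edge by (auto dest: adj_in_verts)
    show "parcs ?F \<subseteq> pverts ?F \<times> pverts ?F"
      unfolding V A by auto
    \<comment> \<open>All 25 ordered pairs of the five vertices are checked one by one.\<close>
    show "(a, b) \<in> parcs ?F \<longleftrightarrow> ?g a \<rightarrow>\<^bsub>G\<^esub> ?g b" if "a \<in> pverts ?F" "b \<in> pverts ?F" for a b
      using that unfolding V A insert_iff empty_iff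
      by (elim disjE FalseE) (simp_all add: path(1,2) edge adj uw wu irr nadj nadj')
  qed
  with free show False by contradiction
qed

section \<open>The total number of colours\<close>

lemma sum_mult_diff: "6 * (\<Sum>j\<le>n. j * (n + 1 - j)) = n * (n + 1) * (n + 2 :: nat)"
proof -
  \<comment> \<open>The induction needs a parameter \<open>m\<close> that stays fixed while
    \<open>n\<close> grows; it becomes \<open>n + 1\<close> afterwards. Real numbers avoid truncated
    subtraction.\<close>
  have "6 * (\<Sum>j\<le>n. real j * (m - j)) = real n * (real n + 1) * (3 * m - 2 * real n - 1)" for m :: real
    by (induction n) (simp_all add: algebra_simps)
  from this[of "real n + 1"]
  have "6 * (\<Sum>j\<le>n. real j * (real n + 1 - j)) =
      real n * (real n + 1) * (3 * (real n + 1) - 2 * real n - 1)" .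
  also have "\<dots> = real n * (real n + 1) * (real n + 2)"
    by simp
  also have "(\<Sum>j\<le>n. real j * (real n + 1 - j)) = real (\<Sum>j\<le>n. j * (n + 1 - j))"
    unfolding of_nat_sum by (intro sum.cong) (auto simp: of_nat_diff)
  finally have "real (6 * (\<Sum>j\<le>n. j * (n + 1 - j))) = real (n * (n + 1) * (n + 2))"
    by (simp only: of_nat_mult of_nat_add of_nat_numeral of_nat_1)
  then show ?thesis
    by (simp only: of_nat_eq_iff)
qed

section \<open>Maximum cliques\<close>

context graph
begin

lemma finite_clique_cards: "finite {card K | K. is_clique G K}"
  by (rule finite_surj[of "Pow (verts G)" _ card]) (auto simp: is_clique_def)

lemma card_clique_le: "is_clique G K \<Longrightarrow> card K \<le> clique_number G"
  unfolding clique_number_def using finite_clique_cards by (intro Max_ge) auto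

lemma obtain_maximum_clique:
  obtains K where "is_clique G K" "card K = clique_number G"
proof -
  \<comment> \<open>The empty clique makes the set under \<open>Max\<close> nonempty, even in the
    graph without vertices.\<close>
  have "is_clique G {}"
    by (simp add: is_clique_def)
  then have "clique_number G \<in> {card K | K. is_clique G K}"
    unfolding clique_number_def using finite_clique_cards by (intro Max_in) auto
  then show ?thesis
    using that by auto
qed

end

section \<open>Colouring the classes of vertices\<close>

theorem theorem1:
  fixes G :: "('a, 'b) pre_digraph" and \<omega> :: nat
  assumes "graph G"
    and "induced_free (with_proj (disjoint_union_graph (path_graph 3) (path_graph 2))) G"
    and "\<omega> = clique_number G"
  shows "real (chromatic_number G) \<le> real (\<omega> * (\<omega> + 1) * (\<omega> + 2)) / 6"
proof -
  interpret graph G by fact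
  let ?r = "arcs_ends G"
  have sym: "sym ?r"
    using sym_arcs by (simp add: symmetric_def)
  then have symD: "a \<rightarrow>\<^bsub>G\<^esub> b \<Longrightarrow> b \<rightarrow>\<^bsub>G\<^esub> a" for a b
    by (auto elim: symE)
  have irr: "\<not> a \<rightarrow>\<^bsub>G\<^esub> a" for a
    using adj_not_same by blast
  obtain A where A: "is_clique G A" "card A = \<omega>"
    using obtain_maximum_clique assms(3) by metis
  have "finite A"
    using A(1) finite_subset[OF _ finite_verts] by (auto simp: is_clique_def)
  then obtain a where a: "bij_betw a {..<\<omega>} A"
    using A(2) ex_bij_betw_nat_finite[of A] by (auto simp: atLeast0LessThan)
  have aA: "a i \<in> A" if "i < \<omega>" for i
    using a that by (auto simp: bij_betw_def)
  have aadj: "a i \<rightarrow>\<^bsub>G\<^esub> a j" if "i < \<omega>" "j < \<omega>" "i \<noteq> j" for i j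
    using A(1) aA a that by (auto simp: is_clique_def bij_betw_def inj_on_eq_iff)
  \<comment> \<open>For \<open>i < j\<close> these are the vertices whose first two non-neighbours
    in the clique are \<open>a i\<close> and \<open>a j\<close>. The value
    \<open>j = \<omega>\<close> stands for a missing second one, hence the guard
    \<open>j < \<omega>\<close>.\<close>
  define D where "D j i = {v \<in> verts G. \<not> v \<rightarrow>\<^bsub>G\<^esub> a i \<and> (\<forall>k<j. k \<noteq> i \<longrightarrow> v \<rightarrow>\<^bsub>G\<^esub> a k) \<and>
    (j < \<omega> \<longrightarrow> \<not> v \<rightarrow>\<^bsub>G\<^esub> a j)}" for i j

  have cover: "verts G \<subseteq> (\<Union>j\<le>\<omega>. \<Union>i<j. D j i)"
  proof
    fix v assume v: "v \<in> verts G"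
    have "\<exists>i<\<omega>. \<not> v \<rightarrow>\<^bsub>G\<^esub> a i"
    proof (rule ccontr)
      assume "\<not> ?thesis"
      then have vA: "v \<rightarrow>\<^bsub>G\<^esub> x" if "x \<in> A" for x
        using that a by (auto simp: bij_betw_def)
      then have "is_clique G (insert v A)"
        using A(1) v symD unfolding is_clique_def by blast
      moreover have "v \<notin> A"
        using vA irr by blast
      ultimately show False
        using card_clique_le[of "insert v A"] A(2) assms(3) \<open>finite A\<close> by simp
    qed
    then obtain i where i: "i < \<omega>" "\<not> v \<rightarrow>\<^bsub>G\<^esub> a i" "\<And>k. k < i \<Longrightarrow> v \<rightarrow>\<^bsub>G\<^esub> a k"
      using exists_least_iff[of "\<lambda>i. i < \<omega> \<and> \<not> v \<rightarrow>\<^bsub>G\<^esub> a i"] by (meson less_trans)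
    \<comment> \<open>\<open>P \<omega>\<close> holds by the guard, so the least \<open>j\<close>
      exists and is at most \<open>\<omega>\<close>. An index \<open>k < j\<close> other than
      \<open>i\<close> gives a neighbour of \<open>v\<close>: below \<open>i\<close> by the choice
      of \<open>i\<close>, above \<open>i\<close> by that of \<open>j\<close>.\<close>
    define P where "P j \<longleftrightarrow> i < j \<and> (j < \<omega> \<longrightarrow> \<not> v \<rightarrow>\<^bsub>G\<^esub> a j)" for j
    define j where "j = (LEAST j. P j)"
    have "P \<omega>"
      using i(1) by (simp add: P_def)
    then have j: "P j" "j \<le> \<omega>" "\<And>k. k < j \<Longrightarrow> \<not> P k"
      unfolding j_def by (auto intro: LeastI Least_le dest: not_less_Least)
    have "v \<rightarrow>\<^bsub>G\<^esub> a k" if "k < j" "k \<noteq> i" for k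
      using that i(3)[of k] j(2) j(3)[of k] by (cases "k < i") (auto simp: P_def)
    then have "v \<in> D j i"
      using v i(2) j(1) by (auto simp: D_def P_def)
    then show "v \<in> (\<Union>j\<le>\<omega>. \<Union>i<j. D j i)"
      using j(1,2) by (auto simp: P_def)
  qed

  have cliqueD: "card K \<le> \<omega> + 1 - j"
    if ij: "i < j" "j \<le> \<omega>" and K: "K \<subseteq> D j i" "\<forall>u\<in>K. \<forall>v\<in>K. u \<noteq> v \<longrightarrow> u \<rightarrow>\<^bsub>G\<^esub> v" for i j K
  proof -
    \<comment> \<open>These \<open>j - 1\<close> clique vertices are adjacent to all of
      \<open>K\<close>, and disjoint from it as there are no loops. So \<open>K\<close> and
      \<open>?B\<close> together form a clique, and
      \<open>card K + (j - 1) \<le> \<omega>\<close>.\<close>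
    let ?B = "a ` ({..<j} - {i})"
    have KB: "u \<rightarrow>\<^bsub>G\<^esub> x" if "u \<in> K" "x \<in> ?B" for u x
      using that K(1) by (auto simp: D_def)
    have BA: "?B \<subseteq> A"
      using aA ij(2) by auto
    have "is_clique G (K \<union> ?B)"
      unfolding is_clique_def
    proof (intro conjI ballI impI)
      show "K \<union> ?B \<subseteq> verts G"
        using K(1) BA A(1) by (auto simp: is_clique_def D_def)
      fix x y assume xy: "x \<in> K \<union> ?B" "y \<in> K \<union> ?B" "x \<noteq> y"
      consider "x \<in> K" "y \<in> K" | "x \<in> K" "y \<in> ?B" | "x \<in> ?B" "y \<in> K" | "x \<in> ?B" "y \<in> ?B"
        using xy by blast
      then show "x \<rightarrow>\<^bsub>G\<^esub> y"
      proof cases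
        case 1
        then show ?thesis using K(2) xy(3) by blast
      next
        case 2
        then show ?thesis by (rule KB)
      next
        case 3
        then show ?thesis using KB symD by blast
      next
        case 4
        then have "x \<in> A" "y \<in> A" using BA by auto
        then show ?thesis using A(1) xy(3) by (simp add: is_clique_def)
      qed
    qed
    then have "card (K \<union> ?B) \<le> \<omega>"
      using card_clique_le assms(3) by simp
    moreover have "finite K"
      using K(1) finite_subset[OF _ finite_verts] by (auto simp: D_def)
    moreover have "K \<inter> ?B = {}"
      using KB irr by blast
    moreover have "card ?B = j - 1"
    proof -
      have "inj_on a ({..<j} - {i})"
        using a ij(2) by (auto simp: bij_betw_def intro: inj_on_subset)
      then show ?thesis
        using ij(1) by (simp add: card_image)
    qed
    ultimately show ?thesis
      using ij by (simp add: card_Un_disjoint)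
  qed

  have "colorable ?r (D j i) (\<omega> + 1 - j)" if ij: "i < j" "j \<le> \<omega>" for i j
  proof (rule colorable_P3_free)
    show "finite (D j i)"
      by (rule finite_subset[OF _ finite_verts]) (auto simp: D_def)
    show "irrefl ?r"
      using irr by (auto simp: irrefl_def)
    show "card K \<le> \<omega> + 1 - j" if "K \<subseteq> D j i" "\<forall>u\<in>K. \<forall>v\<in>K. u \<noteq> v \<longrightarrow> u \<rightarrow>\<^bsub>G\<^esub> v" for K
      using cliqueD[OF ij that] .
    fix u v w
    assume uvw: "u \<in> D j i" "v \<in> D j i" "w \<in> D j i" "u \<rightarrow>\<^bsub>G\<^esub> v" "v \<rightarrow>\<^bsub>G\<^esub> w" "u \<noteq> w"
    show "u \<rightarrow>\<^bsub>G\<^esub> w"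
    proof (cases "j < \<omega>")
      case True
      have aij: "a i \<rightarrow>\<^bsub>G\<^esub> a j"
        using aadj True ij by simp
      show ?thesis
      proof (rule induced_free_P3_P2D[OF assms(1,2) uvw(4-6) aij])
        fix z assume "z \<in> {u, v, w}"
        then have "\<not> z \<rightarrow>\<^bsub>G\<^esub> a i" "\<not> z \<rightarrow>\<^bsub>G\<^esub> a j"
          using uvw True by (auto simp: D_def)
        \<comment> \<open>Each of \<open>a i\<close> and \<open>a j\<close> is adjacent to the
          other, so \<open>z\<close>, adjacent to neither, differs from both.\<close>
        then show "z \<noteq> a i \<and> z \<noteq> a j \<and> \<not> z \<rightarrow>\<^bsub>G\<^esub> a i \<and> \<not> z \<rightarrow>\<^bsub>G\<^esub> a j"
          using aij symD by blast
      qed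
    next
      \<comment> \<open>Here \<open>j = \<omega>\<close>, so cliques in the class have at most one
        vertex and the edge \<open>u v\<close> is impossible.\<close>
      case False
      have "u \<noteq> v"
        using uvw(4) irr by blast
      then have "card {u, v} \<le> \<omega> + 1 - j"
        using uvw symD[OF uvw(4)] by (intro cliqueD[OF ij]) auto
      then show ?thesis
        using False \<open>u \<noteq> v\<close> by simp
    qed
  qed (fact sym)
  then have "colorable ?r (\<Union>j\<le>\<omega>. \<Union>i<j. D j i) (\<Sum>j\<le>\<omega>. \<Sum>i<j. \<omega> + 1 - j)"
    by (intro colorable_UN) auto
  \<comment> \<open>The inner sum over \<open>i < j\<close> has equal terms, which yields the factor
    \<open>j\<close>.\<close>
  from colorable_mono[OF this cover]
  have "\<exists>c. proper_coloring G (\<Sum>j\<le>\<omega>. j * (\<omega> + 1 - j)) c"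
    by (simp add: colorable_def proper_coloring_def)
  then have "chromatic_number G \<le> (\<Sum>j\<le>\<omega>. j * (\<omega> + 1 - j))"
    unfolding chromatic_number_def by (rule Least_le)
  then have "6 * chromatic_number G \<le> \<omega> * (\<omega> + 1) * (\<omega> + 2)"
    using sum_mult_diff[of \<omega>] by linarith
  then have "real (6 * chromatic_number G) \<le> real (\<omega> * (\<omega> + 1) * (\<omega> + 2))"
    by (simp only: of_nat_le_iff)
  then show ?thesis
    by simp
qed

end
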